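(* Assume the $abc$-conjecture. Then \[ \frac{1}{2} \le \theta_4 \le \frac{4}{5}, \qquad \frac{1}{2} \le \theta_5 \le \frac{9}{10}, \qquad \text{and} \qquad \frac{1}{2} \le \theta_k \le 1 - \frac{1}{10 \cdot 3^{k-5}} \ \text{ for all integers } k \ge 5. \]
   Context: A positive integer $n$ is powerful if $p^2 \mid n$ for every prime $p \mid n$. For an integer $k \ge 3$, a $k$-term arithmetic progression of powerful numbers is a sequence $N, N+d, \dots, N+(k-1)d$ with positive integers $N$ and $d$ (so $d>0$) all of whose terms are powerful. A real number $0<\theta<1$ is called an admissible exponent (for $k$) if there exists a constant $C_\theta>0$ such that there are infinitely many $k$-term arithmetic progressions of powerful numbers $N, N+d, \dots, N+(k-1)d$ with $d \le C_\theta N^\theta$; $\theta_k$ denotes the infimum of all admissible exponents for $k$. The $abc$-conjecture states: for every $\epsilon>0$ there is a constant $C_\epsilon>0$ such that for all integers $a,b,c$ with $a+b=c$ and $\gcd(a,b)=1$, one has $\max\{|a|,|b|,|c|\} \le C_\epsilon\, \kappa(abc)^{1+\epsilon}$, where $\kappa(m)=\prod_{p\mid m} p$ is the product of the distinct primes dividing $m$. *)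

theory Defs
  imports "HOL-Analysis.Analysis" "HOL-Computational_Algebra.Computational_Algebra"
begin

definition powerful :: "nat \<Rightarrow> bool" where
  "powerful n \<longleftrightarrow> n > 0 \<and> (\<forall>p. prime p \<longrightarrow> p dvd n \<longrightarrow> p\<^sup>2 dvd n)"

text \<open>A progression is encoded by its first term and its common difference.\<close>

definition powerful_ap :: "nat \<Rightarrow> nat \<Rightarrow> nat \<Rightarrow> bool" where
  "powerful_ap k N d \<longleftrightarrow> N > 0 \<and> d > 0 \<and> (\<forall>i<k. powerful (N + i * d))"

definition admissible_exponent :: "nat \<Rightarrow> real \<Rightarrow> bool" where
  "admissible_exponent k \<theta> \<longleftrightarrow> 0 < \<theta> \<and> \<theta> < 1 \<and>
     (\<exists>C>0. infinite {(N, d). powerful_ap k N d \<and> real d \<le> C * real N powr \<theta>})"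

text \<open>The infimum is taken in the extended reals, so that it is \<open>\<infinity>\<close> if there are no
  admissible exponents; a finite upper bound on it therefore includes their existence.\<close>

definition theta :: "nat \<Rightarrow> ereal" where
  "theta k = Inf (ereal ` {\<theta>. admissible_exponent k \<theta>})"

definition kappa :: "int \<Rightarrow> int" where
  "kappa m = \<Prod>(prime_factors m)"

text \<open>With \<open>prime_factors 0 = {}\<close> we have \<open>kappa 0 = 1\<close>. This convention is immaterial below: a triple
  with \<open>a * b * c = 0\<close>, \<open>a + b = c\<close> and \<open>coprime a b\<close> has all entries in \<open>{-1, 0, 1}\<close>.\<close>

definition abc_conjecture :: bool where
  "abc_conjecture \<longleftrightarrow> (\<forall>\<epsilon>::real. \<epsilon> > 0 \<longrightarrow> (\<exists>C::real. C > 0 \<and>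
     (\<forall>a b c :: int. a + b = c \<longrightarrow> coprime a b \<longrightarrow>
        real_of_int (Max {\<bar>a\<bar>, \<bar>b\<bar>, \<bar>c\<bar>}) \<le> C * real_of_int (kappa (a * b * c)) powr (1 + \<epsilon>))))"

end

theory Submission
  imports Defs
begin

text \<open>Lower bound: for a progression \<open>N = g n\<close>, \<open>d = g e\<close> with \<open>g = gcd N d\<close>, apply \<open>abc\<close> to
  \<open>n (n + 2 e) + e\<^sup>2 = (n + e)\<^sup>2\<close>. With \<open>M = n (n + e) (n + 2 e)\<close>, every prime \<open>p\<close> dividing \<open>M\<close>
  satisfies \<open>p\<^sup>2 dvd g M\<close>, so the radical of \<open>M\<close> is at most \<open>sqrt (g M)\<close>; all powers of \<open>g\<close> then
  cancel and \<open>d\<close> is at least of order \<open>N powr (1/2 - \<epsilon>)\<close>.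

  Upper bound (unconditional): there are infinitely many \<open>M\<close> with \<open>M\<close> and \<open>M + 1\<close> powerful.
  Multiplying \<open>M, \<dots>, M + k - 1\<close> by \<open>P = (M + 2)\<^sup>2 \<cdots> (M + k - 1)\<^sup>2\<close> gives a progression of powerful
  numbers with \<open>d = P\<close> of order \<open>M ^ (2 k - 4)\<close> and \<open>N = M P\<close> of order \<open>M ^ (2 k - 3)\<close>, so
  \<open>1 - 1 / (2 k - 3)\<close> is admissible.\<close>

section \<open>Radicals\<close>

text \<open>Distinct primes are coprime, hence so are their \<open>q\<close>-th powers, and coprime
  divisors of \<open>x\<close> multiply to a divisor of \<open>x\<close>. The case
  \<open>q = 1\<close> compares radicals; \<open>q = 2\<close> serves the powerful terms.\<close>

lemma prod_primes_power_dvd: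
  fixes x :: int
  assumes "finite A" "\<And>p. p \<in> A \<Longrightarrow> prime p" "\<And>p. p \<in> A \<Longrightarrow> p ^ q dvd x"
  shows "(\<Prod>A) ^ q dvd x"
  using assms
proof (induction A rule: finite_induct)
  case (insert p A)
  have "coprime p (\<Prod>A)"
    using insert by (intro prod_coprime_right primes_coprime) auto
  hence "coprime (p ^ q) ((\<Prod>A) ^ q)" by simp
  moreover have "p ^ q dvd x" "(\<Prod>A) ^ q dvd x" using insert by auto
  ultimately have "p ^ q * (\<Prod>A) ^ q dvd x" by (rule divides_mult[rotated 2])
  thus ?case using insert by (simp add: power_mult_distrib)
qed simp

lemma kappa_pos: "kappa m > 0"
  unfolding kappa_def by (intro prod_pos) (auto dest: in_prime_factors_imp_prime prime_gt_0_int)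

lemma kappa_dvd: "m \<noteq> 0 \<Longrightarrow> kappa m dvd m"
  unfolding kappa_def using prod_primes_power_dvd[of "prime_factors m" 1 m]
  by (auto dest: in_prime_factors_imp_prime in_prime_factors_imp_dvd)

text \<open>\<open>x\<close> is kept apart from \<open>m\<close> because later the primes come from
  \<open>M\<close>, while their squares divide only \<open>g * M\<close>.\<close>

lemma kappa_square_dvd:
  assumes "\<And>p. prime p \<Longrightarrow> p dvd m \<Longrightarrow> p\<^sup>2 dvd x"
  shows "(kappa m)\<^sup>2 dvd x"
  unfolding kappa_def using assms
  by (intro prod_primes_power_dvd) (auto dest: in_prime_factors_imp_prime in_prime_factors_imp_dvd)

lemma kappa_mult_le:
  assumes "x \<noteq> 0" "y \<noteq> 0"
  shows "kappa (x * y) \<le> kappa x * kappa y"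
proof -
  have "kappa (x * y) dvd kappa x * kappa y"
  proof -
    have "p dvd kappa x * kappa y" if "p \<in> prime_factors (x * y)" for p
      using that assms unfolding kappa_def
      by (auto simp: prime_factors_product intro: dvd_mult dvd_mult2 dvd_prodI)
    thus ?thesis
      unfolding kappa_def[of "x * y"]
      using prod_primes_power_dvd[of "prime_factors (x * y)" 1 "kappa x * kappa y"]
      by (auto dest: in_prime_factors_imp_prime)
  qed
  thus ?thesis using kappa_pos by (intro zdvd_imp_le) auto
qed

lemma kappa_cong:
  assumes "x \<noteq> 0" "y \<noteq> 0" "\<And>p. prime p \<Longrightarrow> p dvd x \<longleftrightarrow> p dvd y"
  shows "kappa x = kappa y"
proof -
  have "prime_factors x = prime_factors y"
    using assms by (auto simp: in_prime_factors_iff)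
  thus ?thesis by (simp add: kappa_def)
qed

section \<open>The lower bound\<close>

lemma powerful_prime_square_dvd_int:
  assumes "powerful n" "prime p" "p dvd int n"
  shows "p\<^sup>2 dvd int n"
proof -
  have "p \<ge> 0" using assms(2) prime_ge_0_int by blast
  then obtain q where q: "p = int q" using nonneg_int_cases by blast
  have "q\<^sup>2 dvd n"
    using assms unfolding powerful_def q by auto
  thus ?thesis unfolding q by (metis int_dvd_int_iff of_nat_power)
qed

text \<open>The radical \<open>X\<close> is paired with \<open>g\<^sup>2\<close> because multiplying
  the \<open>abc\<close> inequality by \<open>g\<^sup>2\<close> turns \<open>n\<^sup>2\<close> into
  \<open>N\<^sup>2\<close>. The last bound combines \<open>X \<le> kappa M * e\<close> with
  \<open>(kappa M)\<^sup>2 \<le> g * M\<close>.\<close>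

lemma powerful_ap3_abc_triple:
  assumes ap: "powerful_ap 3 N d"
  obtains g n e X where "g \<ge> 1" "int N = g * n" "int d = g * e" "n > 0" "e > 0"
    "coprime (n * (n + 2 * e)) (e\<^sup>2)"
    "X = kappa (n * (n + 2 * e) * e\<^sup>2 * (n + e)\<^sup>2)"
    "(g\<^sup>2 * X)\<^sup>2 \<le> (int N + 2 * int d) ^ 3 * (int d)\<^sup>2"
proof -
  have pw: "powerful (N + i * d)" if "i < 3" for i
    using ap that by (auto simp: powerful_ap_def)
  have N0: "N > 0" "d > 0" using ap by (auto simp: powerful_ap_def)
  define g where "g = gcd (int N) (int d)"
  define n where "n = int N div g"
  define e where "e = int d div g"
  have g: "g > 0" using N0 by (simp add: g_def)
  have Ng: "int N = g * n" and dg: "int d = g * e" by (simp_all add: g_def n_def e_def)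
  have n: "n > 0" using N0 g Ng by (metis of_nat_0_less_iff zero_less_mult_pos)
  have e: "e > 0" using N0 g dg by (metis of_nat_0_less_iff zero_less_mult_pos)
  have cop: "coprime n e"
    unfolding n_def e_def g_def using N0 by (intro div_gcd_coprime) auto
  have "coprime (n + 2 * e) e"
    using cop by (metis coprime_iff_gcd_eq_1 gcd.commute gcd_add_mult mult.commute add.commute)
  with cop have cop2: "coprime (n * (n + 2 * e)) (e\<^sup>2)" by simp
  define M where "M = n * (n + e) * (n + 2 * e)"
  define X where "X = kappa (n * (n + 2 * e) * e\<^sup>2 * (n + e)\<^sup>2)"
  have M: "M > 0" using n e by (simp add: M_def)
  have "X = kappa (M * e)"
    unfolding X_def M_def using n e
    by (intro kappa_cong) (auto simp: prime_dvd_mult_iff prime_dvd_power_iff)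
  also have "\<dots> \<le> kappa M * kappa e" using M e by (intro kappa_mult_le) auto
  also have "\<dots> \<le> kappa M * e"
    using kappa_dvd[of e] e kappa_pos[of M] by (intro mult_left_mono zdvd_imp_le) auto
  finally have X: "X \<le> kappa M * e" .
  \<comment> \<open>The reduced terms \<open>n + i * e\<close> need not be powerful; only their
    multiples by \<open>g\<close> are, which costs one factor \<open>g\<close>.\<close>
  have sq: "(kappa M)\<^sup>2 dvd g * M"
  proof (rule kappa_square_dvd)
    fix p :: int assume p: "prime p" "p dvd M"
    then have "p dvd n + int 0 * e \<or> p dvd n + int 1 * e \<or> p dvd n + int 2 * e"
      by (auto simp: M_def prime_dvd_mult_iff)
    then obtain i where i: "i < 3" "p dvd n + int i * e"
      by (metis numeral_3_eq_3 zero_less_Suc one_less_numeral_iff semiring_norm(77) lessI numeral_2_eq_2)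
    have eq: "int (N + i * d) = g * (n + int i * e)" by (simp add: Ng dg algebra_simps)
    have "p\<^sup>2 dvd g * (n + int i * e)"
      using powerful_prime_square_dvd_int[OF pw[OF i(1)] p(1)] i(2) unfolding eq by auto
    moreover have "n + int i * e dvd M"
    proof -
      have "i = 0 \<or> i = 1 \<or> i = 2" using i(1) by auto
      thus ?thesis unfolding M_def by auto
    qed
    ultimately show "p\<^sup>2 dvd g * M" by (meson dvd_refl dvd_trans mult_dvd_mono)
  qed
  have "(kappa M)\<^sup>2 \<le> g * M" using sq g M by (intro zdvd_imp_le) auto
  have "X\<^sup>2 \<le> (kappa M * e)\<^sup>2"
    using X kappa_pos unfolding X_def by (intro power_mono) (auto intro: less_imp_le)
  also have "\<dots> = (kappa M)\<^sup>2 * e\<^sup>2" by (simp add: power_mult_distrib)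
  also have "\<dots> \<le> g * M * e\<^sup>2" using \<open>(kappa M)\<^sup>2 \<le> g * M\<close> by (intro mult_right_mono) auto
  \<comment> \<open>The total power \<open>g ^ 5\<close> is exactly what turns the three factors of
    \<open>M\<close> and the two factors \<open>e\<close> back into terms of the original
    progression.\<close>
  finally have "g ^ 4 * X\<^sup>2 \<le> g ^ 4 * (g * M * e\<^sup>2)" using g by (intro mult_left_mono) auto
  also have "\<dots> = int N * (int N + int d) * (int N + 2 * int d) * (int d)\<^sup>2"
    unfolding Ng dg M_def by (simp add: algebra_simps power_numeral_reduce)
  also have "\<dots> \<le> (int N + 2 * int d) * (int N + 2 * int d) * (int N + 2 * int d) * (int d)\<^sup>2"
    by (intro mult_right_mono mult_mono) auto
  finally have "(g\<^sup>2 * X)\<^sup>2 \<le> (int N + 2 * int d) ^ 3 * (int d)\<^sup>2"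
    by (simp add: power_mult_distrib power3_eq_cube)
  with g Ng dg n e cop2 X_def show ?thesis by (intro that[of g n e X]) auto
qed

text \<open>Up to the loss from \<open>\<epsilon>\<close>, \<open>abc\<close> bounds
  \<open>n\<^sup>2\<close> by the radical \<open>X\<close>; after scaling by
  \<open>g\<^sup>2\<close>, the bound on \<open>g\<^sup>2 * X\<close> yields the exponent 3/2 and
  the factor \<open>d\<close>. The constant does not depend on \<open>g\<close>.\<close>

lemma abc_powerful_ap3:
  assumes "abc_conjecture" "\<epsilon> > 0"
  obtains C where "C > 0" "\<And>N d. powerful_ap 3 N d \<Longrightarrow>
    real N ^ 2 \<le> C * (real N + 2 * real d) powr (3/2 + 3 * \<epsilon>) * real d"
proof -
  obtain C where C: "C > 0" and abc: "\<And>a b c :: int. a + b = c \<Longrightarrow> coprime a b \<Longrightarrow>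
      real_of_int (Max {\<bar>a\<bar>, \<bar>b\<bar>, \<bar>c\<bar>}) \<le> C * real_of_int (kappa (a * b * c)) powr (1 + \<epsilon>)"
    using assms unfolding abc_conjecture_def by blast
  have "real N ^ 2 \<le> C * (real N + 2 * real d) powr (3/2 + 3 * \<epsilon>) * real d"
    if ap: "powerful_ap 3 N d" for N d
  proof -
    obtain g n e X where h: "g \<ge> 1" "int N = g * n" "int d = g * e" "n > 0" "e > 0"
      "coprime (n * (n + 2 * e)) (e\<^sup>2)"
      "X = kappa (n * (n + 2 * e) * e\<^sup>2 * (n + e)\<^sup>2)"
      "(g\<^sup>2 * X)\<^sup>2 \<le> (int N + 2 * int d) ^ 3 * (int d)\<^sup>2"
      using powerful_ap3_abc_triple[OF ap] .
    define T where "T = real N + 2 * real d"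
    have d: "real d \<ge> 1" "real N \<ge> 1" using ap by (auto simp: powerful_ap_def)
    have T: "T \<ge> 1" "real d \<le> T" using d by (auto simp: T_def)
    have X0: "real_of_int X > 0" using h(7) kappa_pos by simp
    have g1: "real_of_int g \<ge> 1" using h(1) by simp
    have "real_of_int ((g\<^sup>2 * X)\<^sup>2) \<le> real_of_int ((int N + 2 * int d) ^ 3 * (int d)\<^sup>2)"
      using h(8) by (simp only: of_int_le_iff)
    hence "(real_of_int g ^ 2 * real_of_int X)\<^sup>2 \<le> T ^ 3 * (real d)\<^sup>2"
      by (simp add: T_def)
    also have "\<dots> = (T powr (3/2) * real d)\<^sup>2"
    proof -
      have "(T powr (3/2))\<^sup>2 = T powr 3" using T by (simp add: powr_power)
      also have "\<dots> = T ^ 3" using T by simp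
      finally show ?thesis by (simp add: power_mult_distrib)
    qed
    finally have gX: "real_of_int g ^ 2 * real_of_int X \<le> T powr (3/2) * real d"
      by (rule power2_le_imp_le) simp
    \<comment> \<open>A crude bound suffices here: it is used only to replace
      \<open>X powr \<epsilon>\<close> by \<open>T powr (3 * \<epsilon>)\<close>.\<close>
    have "real_of_int X \<le> real_of_int g ^ 2 * real_of_int X"
      using g1 X0 by (simp add: one_le_power)
    also have "\<dots> \<le> T powr (3/2) * T powr (3/2)"
    proof -
      have "real d \<le> T powr 1" using T by simp
      also have "\<dots> \<le> T powr (3/2)" using T by (intro powr_mono) auto
      finally show ?thesis using gX by (smt (verit) mult_left_mono powr_ge_zero)
    qed
    also have "\<dots> = T powr 3" by (simp flip: powr_add)
    finally have XT: "real_of_int X \<le> T powr 3" .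
    have "real_of_int X powr (1 + \<epsilon>) = real_of_int X * real_of_int X powr \<epsilon>"
      using X0 by (simp add: powr_add)
    also have "\<dots> \<le> real_of_int X * (T powr 3) powr \<epsilon>"
      using XT X0 assms(2) by (intro mult_left_mono powr_mono2) auto
    finally have Xp: "real_of_int X powr (1 + \<epsilon>) \<le> real_of_int X * T powr (3 * \<epsilon>)"
      by (simp add: powr_powr)
    let ?a = "n * (n + 2 * e)" and ?b = "e\<^sup>2" and ?c = "(n + e)\<^sup>2"
    have "?a + ?b = ?c" by (simp add: power2_eq_square algebra_simps)
    from abc[OF this h(6)] have A: "real_of_int (Max {\<bar>?a\<bar>, \<bar>?b\<bar>, \<bar>?c\<bar>}) \<le> C * real_of_int X powr (1 + \<epsilon>)"
      by (simp add: h(7))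
    have "n\<^sup>2 \<le> ?c" using h(4,5) by (intro power_mono) auto
    also have "\<dots> \<le> Max {\<bar>?a\<bar>, \<bar>?b\<bar>, \<bar>?c\<bar>}" by (intro Max_ge_iff[THEN iffD2]) auto
    finally have "real_of_int (n\<^sup>2) \<le> real_of_int (Max {\<bar>?a\<bar>, \<bar>?b\<bar>, \<bar>?c\<bar>})" by (simp only: of_int_le_iff)
    also note A
    also have "C * real_of_int X powr (1 + \<epsilon>) \<le> C * (real_of_int X * T powr (3 * \<epsilon>))"
      using Xp C by (intro mult_left_mono) auto
    finally have nX: "real_of_int n ^ 2 \<le> C * (real_of_int X * T powr (3 * \<epsilon>))" by simp
    have "real N = real_of_int g * real_of_int n" using h(2) by (metis of_int_mult of_int_of_nat_eq)
    hence "real N ^ 2 = real_of_int g ^ 2 * real_of_int n ^ 2" by (simp add: power_mult_distrib)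
    also have "\<dots> \<le> real_of_int g ^ 2 * (C * (real_of_int X * T powr (3 * \<epsilon>)))"
      using nX by (intro mult_left_mono) auto
    also have "\<dots> = C * T powr (3 * \<epsilon>) * (real_of_int g ^ 2 * real_of_int X)" by (simp add: algebra_simps)
    also have "\<dots> \<le> C * T powr (3 * \<epsilon>) * (T powr (3/2) * real d)"
      using gX C by (intro mult_left_mono) auto
    also have "\<dots> = C * T powr (3/2 + 3 * \<epsilon>) * real d" by (simp add: powr_add algebra_simps)
    finally show ?thesis by (simp add: T_def)
  qed
  with C that show ?thesis by blast
qed

text \<open>If \<open>\<theta>\<close> were below 1/2, inserting
  \<open>d \<le> C * N powr \<theta>\<close> into the \<open>abc\<close> bound would leave a power
  of \<open>N\<close> below 2 on the right, so \<open>N\<close> and then \<open>d\<close> would be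
  bounded.\<close>

lemma admissible_exponent_ge_half:
  assumes "abc_conjecture" "k \<ge> 3" "admissible_exponent k \<theta>"
  shows "\<theta> \<ge> 1/2"
proof (rule ccontr)
  assume "\<not> \<theta> \<ge> 1/2"
  \<comment> \<open>Chosen so that \<theta> = 1/2 - 6 \<epsilon>; the exponents 3/2 + 3 \<epsilon>
    and \<theta> then add up to 2 - 3 \<epsilon>.\<close>
  define \<epsilon> where "\<epsilon> = (1/2 - \<theta>) / 6"
  have eps: "\<epsilon> > 0" using \<open>\<not> \<theta> \<ge> 1/2\<close> by (simp add: \<epsilon>_def)
  have th: "0 < \<theta>" "\<theta> < 1" using assms(3) by (auto simp: admissible_exponent_def)
  obtain C where C: "C > 0" and
    inf: "infinite {(N, d). powerful_ap k N d \<and> real d \<le> C * real N powr \<theta>}" (is "infinite ?S")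
    using assms(3) by (auto simp: admissible_exponent_def)
  obtain K where K: "K > 0" and bound: "\<And>N d. powerful_ap 3 N d \<Longrightarrow>
      real N ^ 2 \<le> K * (real N + 2 * real d) powr (3/2 + 3 * \<epsilon>) * real d"
    using abc_powerful_ap3[OF assms(1) eps] by blast
  define L where "L = K * (1 + 2 * C) powr (3/2 + 3 * \<epsilon>) * C"
  define B where "B = L powr (1 / (3 * \<epsilon>))"
  have "real N \<le> B \<and> real d \<le> C * B" if S: "(N, d) \<in> ?S" for N d
  proof -
    have ap: "powerful_ap 3 N d" and dN: "real d \<le> C * real N powr \<theta>"
      using S assms(2) by (auto simp: powerful_ap_def)
    have N: "real N \<ge> 1" using ap by (auto simp: powerful_ap_def)
    have "real N powr \<theta> \<le> real N powr 1" using N th by (intro powr_mono) auto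
    hence "real N powr \<theta> \<le> real N" by simp
    \<comment> \<open>Since \<theta> < 1, the sum \<open>N + 2 * d\<close> is at most
      \<open>(1 + 2 * C) * N\<close>.\<close>
    hence dCN: "real d \<le> C * real N" using dN C by (smt (verit) mult_left_mono)
    have "real N powr 2 = real N ^ 2" using N by simp
    also have "\<dots> \<le> K * (real N + 2 * real d) powr (3/2 + 3 * \<epsilon>) * real d" by (rule bound[OF ap])
    also have "\<dots> \<le> K * ((1 + 2 * C) * real N) powr (3/2 + 3 * \<epsilon>) * (C * real N powr \<theta>)"
      using K C eps dCN dN by (intro mult_mono powr_mono2) (auto simp: algebra_simps)
    also have "\<dots> = L * (real N powr (3/2 + 3 * \<epsilon>) * real N powr \<theta>)"
      using C by (simp add: L_def powr_mult)
    also have "real N powr (3/2 + 3 * \<epsilon>) * real N powr \<theta> = real N powr (2 - 3 * \<epsilon>)"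
      by (simp add: \<epsilon>_def field_simps flip: powr_add)
    finally have "real N powr (2 - 3 * \<epsilon>) * real N powr (3 * \<epsilon>) \<le> real N powr (2 - 3 * \<epsilon>) * L"
      by (simp add: mult.commute flip: powr_add)
    moreover have "real N powr (2 - 3 * \<epsilon>) > 0" using N by simp
    ultimately have "real N powr (3 * \<epsilon>) \<le> L" by simp
    hence "(real N powr (3 * \<epsilon>)) powr (1 / (3 * \<epsilon>)) \<le> B"
      unfolding B_def using eps by (intro powr_mono2) auto
    hence "real N \<le> B" using N eps by (simp add: powr_powr)
    with dCN C show ?thesis by (smt (verit) mult_left_mono)
  qed
  hence "?S \<subseteq> {..nat \<lfloor>B\<rfloor>} \<times> {..nat \<lfloor>C * B\<rfloor>}"
    by (auto simp: le_nat_floor)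
  hence "finite ?S" by (rule finite_subset) auto
  with inf show False by simp
qed

section \<open>The upper bound\<close>

lemma powerful_mult: "powerful a \<Longrightarrow> powerful b \<Longrightarrow> powerful (a * b)"
  unfolding powerful_def by (auto simp: prime_dvd_mult_iff)

lemma powerful_power:
  assumes "a > 0" "q \<ge> 2"
  shows "powerful (a ^ q)"
proof -
  have "p\<^sup>2 dvd a ^ q" if "prime p" "p dvd a ^ q" for p
    using that assms by (meson dvd_power_le prime_dvd_power)
  thus ?thesis using assms by (auto simp: powerful_def)
qed

lemma powerful_square: "a > 0 \<Longrightarrow> powerful (a\<^sup>2)"
  by (rule powerful_power) auto

text \<open>From a pair \<open>M\<close>, \<open>M + 1\<close> one gets the larger pair
  \<open>4 * M * (M + 1)\<close>, \<open>(2 * M + 1)\<^sup>2\<close>; the start is 8, 9.\<close>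

lemma infinite_consecutive_powerful: "infinite {M. powerful M \<and> powerful (M + 1)}"
proof -
  have "\<exists>M\<ge>n. powerful M \<and> powerful (M + 1)" for n
  proof (induction n)
    case 0
    have "powerful (2 ^ 3)" by (rule powerful_power) auto
    moreover have "powerful (3\<^sup>2)" by (rule powerful_square) simp
    ultimately show ?case by (intro exI[of _ 8]) auto
  next
    case (Suc n)
    then obtain M where M: "M \<ge> n" "powerful M" "powerful (M + 1)" by blast
    have "M > 0" using M(2) by (simp add: powerful_def)
    have "powerful (2\<^sup>2 * (M * (M + 1)))"
      using M by (intro powerful_mult powerful_square) auto
    moreover have "powerful ((2 * M + 1)\<^sup>2)" by (rule powerful_square) simp
    moreover have "2\<^sup>2 * (M * (M + 1)) + 1 = (2 * M + 1)\<^sup>2" by (simp add: power2_eq_square algebra_simps)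
    moreover have "2\<^sup>2 * (M * (M + 1)) \<ge> Suc n" using M(1) \<open>M > 0\<close> by simp
    ultimately show ?case by metis
  qed
  thus ?thesis unfolding infinite_nat_iff_unbounded_le by auto
qed

text \<open>The terms are \<open>(M + i) * P\<close>. For \<open>i < 2\<close> both factors are
  powerful; for larger \<open>i\<close> every prime of \<open>M + i\<close> already divides the
  powerful number \<open>P\<close>.\<close>

lemma powerful_ap_of_consecutive:
  fixes M k :: nat
  assumes "powerful M" "powerful (M + 1)"
  defines "P \<equiv> (\<Prod>j\<in>{2..<k}. (M + j)\<^sup>2)"
  shows "powerful_ap k (M * P) P"
proof -
  have M: "M > 0" using assms(1) by (simp add: powerful_def)
  have PQ: "P = (\<Prod>j\<in>{2..<k}. M + j)\<^sup>2" by (simp add: P_def prod_power_distrib)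
  have P: "powerful P" unfolding PQ using M by (intro powerful_square prod_pos) auto
  have "powerful (M * P + i * P)" if "i < k" for i
  proof (cases "i < 2")
    case True
    hence "powerful (M + i)" using assms(1,2) by (auto simp: less_2_cases_iff)
    thus ?thesis using powerful_mult[OF _ P] by (simp flip: distrib_right)
  next
    case False
    hence dvd: "(M + i)\<^sup>2 dvd P" unfolding P_def using that by (intro dvd_prodI) auto
    have "p\<^sup>2 dvd P" if p: "prime p" "p dvd (M + i) * P" for p
    proof -
      have "p dvd P"
        using p dvd by (metis dvd_trans dvd_triv_left power2_eq_square prime_dvd_mult_iff)
      thus ?thesis using P p(1) by (auto simp: powerful_def)
    qed
    hence "powerful ((M + i) * P)" using P M by (auto simp: powerful_def)
    thus ?thesis by (simp flip: distrib_right)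
  qed
  thus ?thesis using M P by (auto simp: powerful_ap_def powerful_def)
qed

text \<open>Writing \<open>m\<close> for the degree of \<open>P\<close> in \<open>M\<close>, the
  difference has degree \<open>m\<close> and the first term degree \<open>m + 1\<close>, so the
  exponent is \<open>m / (m + 1)\<close>.\<close>

lemma admissible_exponent_consecutive:
  assumes "k \<ge> 3"
  shows "admissible_exponent k (1 - 1 / (2 * real k - 3))"
proof -
  define m where "m = 2 * (k - 2)"
  define \<theta> where "\<theta> = 1 - 1 / (2 * real k - 3)"
  have m: "real m = 2 * real k - 4" using assms by (simp add: m_def of_nat_diff)
  have k3: "2 * real k - 3 \<ge> 3" using assms by simp
  have th: "0 < \<theta>" "\<theta> < 1" using k3 by (auto simp: \<theta>_def field_simps)
  \<comment> \<open>This balance makes \<open>P powr (1 - \<theta>)\<close>, of degree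
    \<open>m * (1 - \<theta>)\<close> in \<open>M\<close>, match
    \<open>M powr \<theta>\<close>.\<close>
  have th_eq: "\<theta> = real m * (1 - \<theta>)" using k3 by (simp add: \<theta>_def m field_simps)
  define P where "P M = (\<Prod>j\<in>{2..<k}. (M + j)\<^sup>2)" for M :: nat
  define C where "C = (real (k + 1) ^ m) powr (1 - \<theta>)"
  have C: "C > 0" by (simp add: C_def)
  let ?A = "{M. powerful M \<and> powerful (M + 1)}"
  let ?f = "\<lambda>M. (M * P M, P M)"
  have pos: "M > 0" if "M \<in> ?A" for M using that by (simp add: powerful_def)
  have Ppos: "P M > 0" if "M \<in> ?A" for M
    unfolding P_def using pos[OF that] by (intro prod_pos) auto
  \<comment> \<open>Equal pairs share the positive factor \<open>P M\<close>, which cancels in the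
    first component.\<close>
  have inj: "inj_on ?f ?A"
    using Ppos by (intro inj_onI) (metis (no_types, lifting) mult_right_cancel less_numeral_extra(3) prod.inject)
  have bound: "real (P M) \<le> C * real (M * P M) powr \<theta>" if M: "M \<in> ?A" for M
  proof -
    have "P M \<le> (\<Prod>j\<in>{2..<k}. ((k + 1) * M)\<^sup>2)"
      unfolding P_def
    proof (intro prod_mono conjI power_mono)
      fix j assume "j \<in> {2..<k}"
      hence "j \<le> k * M" using pos[OF M] by (metis atLeastLessThan_iff less_imp_le_nat le_trans nat_mult_le_cancel_disj mult.right_neutral Suc_leI One_nat_def)
      thus "M + j \<le> (k + 1) * M" by simp
    qed auto
    also have "\<dots> = ((k + 1) * M) ^ m" by (simp add: m_def power_mult)
    finally have "real (P M) \<le> real (k + 1) ^ m * real M ^ m"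
      by (metis of_nat_le_iff of_nat_mult of_nat_power power_mult_distrib)
    hence "real (P M) powr (1 - \<theta>) \<le> (real (k + 1) ^ m * real M ^ m) powr (1 - \<theta>)"
      using th by (intro powr_mono2) auto
    also have "\<dots> = C * (real M ^ m) powr (1 - \<theta>)" unfolding C_def by (simp add: powr_mult)
    also have "(real M ^ m) powr (1 - \<theta>) = real M powr \<theta>"
    proof -
      have "real M ^ m = real M powr real m" using pos[OF M] by (simp add: powr_realpow)
      thus ?thesis using th_eq by (simp add: powr_powr)
    qed
    finally have le: "real (P M) powr (1 - \<theta>) \<le> C * real M powr \<theta>" .
    \<comment> \<open>Only the part with exponent \<open>1 - \<theta>\<close> is estimated; the rest
      joins \<open>M powr \<theta>\<close> to form \<open>(M * P M) powr \<theta>\<close>.\<close>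
    have "real (P M) = real (P M) powr (1 - \<theta>) * real (P M) powr \<theta>"
      using Ppos[OF M] by (simp flip: powr_add)
    also have "\<dots> \<le> C * real M powr \<theta> * real (P M) powr \<theta>"
      using le by (intro mult_right_mono) auto
    also have "\<dots> = C * real (M * P M) powr \<theta>" by (simp add: powr_mult)
    finally show ?thesis .
  qed
  have "?f ` ?A \<subseteq> {(N, d). powerful_ap k N d \<and> real d \<le> C * real N powr \<theta>}"
    using bound powerful_ap_of_consecutive[where k = k] unfolding P_def by blast
  moreover have "infinite (?f ` ?A)"
    using infinite_consecutive_powerful inj by (simp add: finite_image_iff)
  ultimately have "infinite {(N, d). powerful_ap k N d \<and> real d \<le> C * real N powr \<theta>}"
    using finite_subset by blast
  thus ?thesis using th C unfolding admissible_exponent_def \<theta>_def by blast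
qed

section \<open>Passing to the infimum and comparing exponents\<close>

lemma theta_ge_half:
  assumes "abc_conjecture" "k \<ge> 3"
  shows "ereal (1/2) \<le> theta k"
  unfolding theta_def using admissible_exponent_ge_half[OF assms] by (intro Inf_greatest) auto

lemma theta_le:
  assumes "k \<ge> 3" "1 - 1 / (2 * real k - 3) \<le> x"
  shows "theta k \<le> ereal x"
proof -
  have "theta k \<le> ereal (1 - 1 / (2 * real k - 3))"
    unfolding theta_def using admissible_exponent_consecutive[OF assms(1)] by (intro Inf_lower) auto
  also have "\<dots> \<le> ereal x" using assms(2) by simp
  finally show ?thesis .
qed

text \<open>With \<open>n = k - 5\<close> this puts the linear denominator \<open>2 * k - 3\<close>
  below the exponential one of the stated bound.\<close>

lemma linear_le_power3: "2 * (real n + 5) - 3 \<le> 10 * 3 ^ n"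
proof (induction n)
  case (Suc n)
  have "(1::real) \<le> 3 ^ n" by simp
  with Suc show ?case by simp
qed simp

theorem theorem3:
  assumes "abc_conjecture"
  shows "ereal (1/2) \<le> theta 4 \<and> theta 4 \<le> ereal (4/5) \<and>
         ereal (1/2) \<le> theta 5 \<and> theta 5 \<le> ereal (9/10) \<and>
         (\<forall>k\<ge>5. ereal (1/2) \<le> theta k \<and> theta k \<le> ereal (1 - 1 / (10 * 3 ^ (k - 5))))"
proof -
  have "theta k \<le> ereal (1 - 1 / (10 * 3 ^ (k - 5)))" if "k \<ge> 5" for k
  proof (rule theta_le)
    have "2 * real k - 3 \<le> 10 * 3 ^ (k - 5)"
      using linear_le_power3[of "k - 5"] that by (simp add: of_nat_diff)
    thus "1 - 1 / (2 * real k - 3) \<le> 1 - 1 / (10 * 3 ^ (k - 5))"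
      using that by (intro diff_left_mono divide_left_mono) auto
  qed (use that in auto)
  \<comment> \<open>The constructed exponent is exactly 4/5 for \<open>k = 4\<close>, and 6/7, below
    9/10, for \<open>k = 5\<close>.\<close>
  moreover have "theta 4 \<le> ereal (4/5)" "theta 5 \<le> ereal (9/10)"
    by (rule theta_le; simp)+
  ultimately show ?thesis using theta_ge_half[OF assms] by auto
qed

end
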